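(* Let $m,n$ be positive integers and $r$ an integer such that $\gcd(m,n)=\gcd(m,r-1)=1$ and $r^n\equiv 1\pmod m$, and let $$\mathrm{ZM}(m,n,r)=\langle a,b\mid a^m=b^n=1,\ b^{-1}ab=a^r\rangle.$$ Then $$\operatorname{cdeg}(\mathrm{ZM}(m,n,r))=\frac{\displaystyle\sum_{m_1\mid m}\ \sum_{\substack{n_1\mid n\\ (m/m_1)\,\mid\, r^{n_1}-1}}\gcd\left(m_1,\frac{r^n-1}{r^{n_1}-1}\right)}{\displaystyle\sum_{m_1\mid m}\ \sum_{n_1\mid n}\gcd\left(m_1,\frac{r^n-1}{r^{n_1}-1}\right)},$$ where $m_1$ and $n_1$ run over positive divisors of $m$ and $n$ respectively (in the numerator, only those pairs for which $m/m_1$ divides $r^{n_1}-1$).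
   Context: For a finite group $G$, let $L(G)$ be the set of all subgroups of $G$ and $C(G)$ the set of all cyclic subgroups of $G$. The cyclicity degree of $G$ is $\operatorname{cdeg}(G)=|C(G)|/|L(G)|$. The group $\mathrm{ZM}(m,n,r)$ is finite of order $mn$ (a ZM-group: a finite group all of whose Sylow subgroups are cyclic). For $n_1\mid n$, the quotient $\frac{r^n-1}{r^{n_1}-1}$ denotes the integer $\sum_{j=0}^{n/n_1-1} r^{jn_1}$, also when $r^{n_1}=1$. *)

theory Defs
  imports Complex_Main "HOL-Algebra.Elementary_Groups" "HOL-Number_Theory.Cong"
begin

text \<open>
  A word is a list of letters; the letter \<open>(g, True)\<close> stands for the generator \<open>g\<close>
  and \<open>(g, False)\<close> for its formal inverse. Every element of the type \<open>'g\<close> is a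
  generator. A relation \<open>u = v\<close> is the pair \<open>(u, v)\<close>.
\<close>

type_synonym 'g word = "('g \<times> bool) list"

text \<open>The least congruence on words containing the free cancellations and \<open>R\<close>.\<close>

inductive word_eq :: "('g word \<times> 'g word) set \<Rightarrow> 'g word \<Rightarrow> 'g word \<Rightarrow> bool"
  for R :: "('g word \<times> 'g word) set" where
  rel: "(u, v) \<in> R \<Longrightarrow> word_eq R u v"
| cancel: "word_eq R [(g, e), (g, \<not> e)] []"
| refl: "word_eq R u u"
| sym: "word_eq R u v \<Longrightarrow> word_eq R v u"
| trans: "word_eq R u v \<Longrightarrow> word_eq R v w \<Longrightarrow> word_eq R u w"
| append: "word_eq R u u' \<Longrightarrow> word_eq R v v' \<Longrightarrow> word_eq R (u @ v) (u' @ v')"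

definition word_class :: "('g word \<times> 'g word) set \<Rightarrow> 'g word \<Rightarrow> 'g word set"
  where "word_class R u = {v. word_eq R u v}"

definition presented_group :: "('g word \<times> 'g word) set \<Rightarrow> 'g word set monoid"
  where "presented_group R =
    \<lparr>carrier = range (word_class R),
     monoid.mult = (\<lambda>X Y. \<Union>x\<in>X. \<Union>y\<in>Y. word_class R (x @ y)),
     monoid.one = word_class R []\<rparr>"

definition word_inv :: "'g word \<Rightarrow> 'g word"
  where "word_inv u = rev (map (\<lambda>(g, e). (g, \<not> e)) u)"

definition word_pow :: "'g \<Rightarrow> int \<Rightarrow> 'g word"
  where "word_pow g k = replicate (nat \<bar>k\<bar>) (g, k \<ge> 0)"

lemma word_class_eq_iff: "word_class R u = word_class R v \<longleftrightarrow> word_eq R u v"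
proof
  assume "word_class R u = word_class R v"
  moreover have "v \<in> word_class R v" by (simp add: word_class_def word_eq.refl)
  ultimately show "word_eq R u v" unfolding word_class_def by blast
next
  assume uv: "word_eq R u v"
  have "word_eq R u w \<longleftrightarrow> word_eq R v w" for w
    using word_eq.trans[OF uv] word_eq.trans[OF word_eq.sym[OF uv]] by blast
  then show "word_class R u = word_class R v" by (simp add: word_class_def)
qed

lemma carrier_presented_group: "carrier (presented_group R) = range (word_class R)"
  by (simp add: presented_group_def)

lemma one_presented_group: "\<one>\<^bsub>presented_group R\<^esub> = word_class R []"
  by (simp add: presented_group_def)

lemma mult_presented_group:
  "word_class R u \<otimes>\<^bsub>presented_group R\<^esub> word_class R v = word_class R (u @ v)"
proof -
  have "word_class R (x @ y) = word_class R (u @ v)"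
    if "x \<in> word_class R u" "y \<in> word_class R v" for x y
  proof -
    have "word_eq R u x" "word_eq R v y" using that by (simp_all add: word_class_def)
    then show ?thesis unfolding word_class_eq_iff by (rule word_eq.sym[OF word_eq.append])
  qed
  moreover have "u \<in> word_class R u" "v \<in> word_class R v"
    by (simp_all add: word_class_def word_eq.refl)
  ultimately have "(\<Union>x\<in>word_class R u. \<Union>y\<in>word_class R v. word_class R (x @ y))
      = word_class R (u @ v)"
    by blast
  then show ?thesis by (simp add: presented_group_def)
qed

lemma word_eq_inv_left: "word_eq R (word_inv u @ u) []"
proof (induction u)
  case Nil
  show ?case by (simp add: word_inv_def word_eq.refl)
next
  case (Cons x u)
  obtain g e where x: "x = (g, e)" by (cases x)
  have "word_eq R [(g, \<not> e), (g, e)] []" using word_eq.cancel[of R g "\<not> e"] by simp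
  then have "word_eq R (word_inv u @ [(g, \<not> e), (g, e)] @ u) (word_inv u @ [] @ u)"
    by (intro word_eq.append word_eq.refl)
  then have "word_eq R (word_inv (x # u) @ x # u) (word_inv u @ u)"
    by (simp add: x word_inv_def)
  then show ?case using Cons.IH by (rule word_eq.trans)
qed

lemma group_presented_group: "group (presented_group R)"
proof (rule groupI)
  fix x assume "x \<in> carrier (presented_group R)"
  then obtain u where "x = word_class R u" by (auto simp: carrier_presented_group)
  moreover have "word_class R (word_inv u) \<otimes>\<^bsub>presented_group R\<^esub> word_class R u
      = \<one>\<^bsub>presented_group R\<^esub>"
    by (simp add: mult_presented_group one_presented_group word_class_eq_iff word_eq_inv_left)
  ultimately show "\<exists>y\<in>carrier (presented_group R). y \<otimes>\<^bsub>presented_group R\<^esub> x = \<one>\<^bsub>presented_group R\<^esub>"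
    by (auto simp: carrier_presented_group)
qed (auto simp: carrier_presented_group mult_presented_group one_presented_group)

text \<open>
  The value of a word under an assignment of the generators to elements of a group, and
  the universal property of the presentation.
\<close>

primrec word_eval :: "('a, 'b) monoid_scheme \<Rightarrow> ('g \<Rightarrow> 'a) \<Rightarrow> 'g word \<Rightarrow> 'a" where
  "word_eval G f [] = \<one>\<^bsub>G\<^esub>"
| "word_eval G f (x # u) =
    (if snd x then f (fst x) else inv\<^bsub>G\<^esub> f (fst x)) \<otimes>\<^bsub>G\<^esub> word_eval G f u"

lemma word_eval_closed:
  assumes "group G" "\<And>g. f g \<in> carrier G"
  shows "word_eval G f u \<in> carrier G"
proof -
  interpret group G by fact
  show ?thesis by (induction u) (use assms in auto)
qed

lemma word_eval_append:
  assumes "group G" "\<And>g. f g \<in> carrier G"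
  shows "word_eval G f (u @ v) = word_eval G f u \<otimes>\<^bsub>G\<^esub> word_eval G f v"
proof -
  interpret group G by fact
  show ?thesis
    by (induction u) (use assms in \<open>auto simp: word_eval_closed m_assoc\<close>)
qed

lemma word_eval_cong:
  assumes G: "group G" and f: "\<And>g. f g \<in> carrier G"
    and R: "\<And>u v. (u, v) \<in> R \<Longrightarrow> word_eval G f u = word_eval G f v"
    and eq: "word_eq R u v"
  shows "word_eval G f u = word_eval G f v"
  using eq
proof induction
  case (cancel g e)
  interpret group G by fact
  show ?case using f by (cases e) auto
qed (auto simp: R word_eval_append[OF G f])

lemma presented_group_universal:
  assumes G: "group G" and f: "\<And>g. f g \<in> carrier G"
    and R: "\<And>u v. (u, v) \<in> R \<Longrightarrow> word_eval G f u = word_eval G f v"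
  shows "\<exists>h \<in> hom (presented_group R) G. \<forall>g. h (word_class R [(g, True)]) = f g"
proof
  define h where "h X = word_eval G f (SOME u. u \<in> X)" for X
  have h: "h (word_class R u) = word_eval G f u" for u
  proof -
    have "u \<in> word_class R u" by (simp add: word_class_def word_eq.refl)
    then have "(SOME v. v \<in> word_class R u) \<in> word_class R u" by (rule someI)
    then show ?thesis
      unfolding h_def using word_eval_cong[OF G f R] by (simp add: word_class_def)
  qed
  show "h \<in> hom (presented_group R) G"
    by (rule homI) (auto simp: carrier_presented_group mult_presented_group h
      word_eval_append[OF G f] word_eval_closed[OF G f])
  interpret group G by fact
  show "\<forall>g. h (word_class R [(g, True)]) = f g" using f by (simp add: h)
qed

datatype zm_gen = gen_a | gen_b

definition ZM :: "nat \<Rightarrow> nat \<Rightarrow> int \<Rightarrow> zm_gen word set monoid"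
  where "ZM m n r = presented_group
    {(word_pow gen_a (int m), []),
     (word_pow gen_b (int n), []),
     (word_pow gen_b (-1) @ word_pow gen_a 1 @ word_pow gen_b 1, word_pow gen_a r)}"

definition subgroups_of :: "('a, 'b) monoid_scheme \<Rightarrow> 'a set set"
  where "subgroups_of G = {H. subgroup H G}"

definition cyclic_subgroups_of :: "('a, 'b) monoid_scheme \<Rightarrow> 'a set set"
  where "cyclic_subgroups_of G = {H. subgroup H G \<and> cyclic_group (G\<lparr>carrier := H\<rparr>)}"

definition cdeg :: "('a, 'b) monoid_scheme \<Rightarrow> real"
  where "cdeg G = real (card (cyclic_subgroups_of G)) / real (card (subgroups_of G))"

definition geom_quot :: "int \<Rightarrow> nat \<Rightarrow> nat \<Rightarrow> int"
  where "geom_quot r n k = (\<Sum>j<n div k. r ^ (j * k))"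

lemma geom_quot_mult:
  assumes "k dvd n"
  shows "geom_quot r n k * (r ^ k - 1) = r ^ n - 1"
proof -
  have "r ^ n - 1 = (r ^ k) ^ (n div k) - 1"
    using assms by (simp add: power_mult[symmetric])
  also have "\<dots> = (r ^ k - 1) * (\<Sum>j<n div k. (r ^ k) ^ j)" by (rule power_diff_1_eq)
  finally have *: "r ^ n - 1 = (r ^ k - 1) * (\<Sum>j<n div k. (r ^ k) ^ j)" .
  have "r ^ (j * k) = (r ^ k) ^ j" for j by (metis mult.commute power_mult)
  then show ?thesis unfolding * geom_quot_def by (simp only: mult.commute)
qed

end

theory Submission
  imports Defs "HOL-Algebra.Multiplicative_Group"
begin

text \<open>
  Every element of the group is uniquely \<open>b\<^sup>i a\<^sup>j\<close> with \<open>i\<close> modulo \<open>n\<close> and \<open>j\<close> modulo \<open>m\<close>;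
  uniqueness comes from mapping the presentation onto the semidirect product of residues.
  A subgroup \<open>H\<close> meets \<open>\<langle>a\<rangle>\<close> in some \<open>\<langle>a\<^bsup>m1\<^esup>\<rangle>\<close> and projects onto some \<open>\<langle>b\<^bsup>n1\<^esup>\<rangle>\<close>, so
  \<open>H = \<langle>b\<^bsup>n1\<^esup> a\<^sup>s, a\<^bsup>m1\<^esup>\<rangle>\<close> with \<open>s\<close> determined modulo \<open>m1\<close>. Since the power of \<open>b\<^bsup>n1\<^esup> a\<^sup>s\<close> to
  \<open>n / n1\<close> is \<open>a\<close> to \<open>s (r\<^sup>n - 1) / (r\<^bsup>n1\<^esup> - 1)\<close>, the possible \<open>s\<close> are those for which \<open>m1\<close>
  divides this exponent, and they are counted by the gcd. As \<open>m\<close> and \<open>n\<close> are coprime, \<open>H\<close> is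
  cyclic iff it is abelian, i.e. iff \<open>m\<close> divides \<open>m1 (r\<^bsup>n1\<^esup> - 1)\<close>.
\<close>

section \<open>Partial geometric sums and linear congruences\<close>

text \<open>With \<open>d = i\<close>, this is the factor that the exponent of \<open>a\<close>
  acquires in the \<open>k\<close>-th power of \<open>b^i a^j\<close>. The length \<open>k\<close>
  is free so that induction on it is possible; \<open>geom_quot r n d\<close> is the case
  \<open>k = n div d\<close>.\<close>

definition gsum :: "int \<Rightarrow> nat \<Rightarrow> nat \<Rightarrow> int"
  where "gsum r d k = (\<Sum>t<k. r ^ (t * d))"

lemma gsum_0 [simp]: "gsum r d 0 = 0"
  by (simp add: gsum_def)

lemma gsum_Suc: "gsum r d (Suc k) = gsum r d k * r ^ d + 1"
  unfolding gsum_def by (subst sum.lessThan_Suc_shift) (simp add: sum_distrib_left power_add mult.commute)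

lemma gsum_add: "gsum r d (k + l) = gsum r d k * r ^ (d * l) + gsum r d l"
  by (induction l) (simp_all add: gsum_Suc power_add algebra_simps)

lemma geom_quot_eq_gsum: "geom_quot r n d = gsum r d (n div d)"
  by (simp add: geom_quot_def gsum_def)

text \<open>Dividing \<open>k\<close> and \<open>q\<close> by their gcd \<open>d\<close> leaves
  coprime \<open>u\<close> and \<open>v\<close>, so the solutions are the multiples of
  \<open>u\<close> below \<open>d * u\<close>, and there are \<open>d\<close> of them.\<close>

lemma card_dvd_mult_eq_gcd:
  fixes q :: int
  assumes "k > 0"
  shows "int (card {s. s < k \<and> int k dvd int s * q}) = gcd (int k) q"
proof -
  define d where "d = nat (gcd (int k) q)"
  have d: "int d = gcd (int k) q" by (simp add: d_def)
  have "d > 0" using d assms by (metis gcd_pos_int of_nat_0_less_iff less_irrefl)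
  obtain u where u: "k = d * u" using d by (metis dvdE gcd_dvd1 int_dvd_int_iff)
  obtain v where v: "q = int d * v" using d by (metis dvdE gcd_dvd2)
  have "u > 0" using u assms by (cases u) auto
  have "int d * gcd (int u) v = int d"
    using u v d by (metis gcd_mult_distrib_int abs_of_nat of_nat_mult)
  then have cop: "coprime (int u) v" using \<open>d > 0\<close> by (simp add: coprime_iff_gcd_eq_1)
  have dvd: "int k dvd int s * q \<longleftrightarrow> u dvd s" for s
  proof -
    have "int k dvd int s * q \<longleftrightarrow> int d * int u dvd int d * (int s * v)"
      by (simp add: u v mult.left_commute)
    also have "\<dots> \<longleftrightarrow> int u dvd int s * v" using \<open>d > 0\<close> by simp
    also have "\<dots> \<longleftrightarrow> u dvd s" using cop by (simp add: coprime_dvd_mult_left_iff)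
    finally show ?thesis .
  qed
  have "{s. s < k \<and> int k dvd int s * q} = (\<lambda>t. u * t) ` {..<d}"
    unfolding dvd using \<open>u > 0\<close> by (auto simp: u elim!: dvdE)
  moreover have "inj_on (\<lambda>t. u * t) {..<d}" using \<open>u > 0\<close> by (auto simp: inj_on_def)
  ultimately show ?thesis by (simp add: card_image d)
qed

text \<open>Subtraction modulo \<open>n\<close> is addition of a multiple, so closure under addition is enough.\<close>

lemma periodic_add_closed_eq_multiples:
  fixes n :: nat
  assumes "n > 0" and zero: "P 0" and add: "\<And>x y. P x \<Longrightarrow> P y \<Longrightarrow> P (x + y)"
    and per: "\<And>x y. P x \<Longrightarrow> [x = y] (mod n) \<Longrightarrow> P y"
  shows "\<exists>d. d dvd n \<and> (\<forall>x. P x \<longleftrightarrow> d dvd x)"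
proof -
  have Pn: "P n" using zero by (rule per) (simp add: cong_def)
  define d where "d = (LEAST x. x > 0 \<and> P x)"
  have d: "d > 0" "P d"
    using LeastI[of "\<lambda>x. x > 0 \<and> P x" n] Pn \<open>n > 0\<close> by (auto simp: d_def)
  have least: "d \<le> x" if "x > 0" "P x" for x using that by (auto simp: d_def intro: Least_le)
  have mult: "P (d * k)" for k by (induction k) (auto simp: zero add d)
  have iff: "P x \<longleftrightarrow> d dvd x" for x
  proof
    assume "P x"
    obtain n' where n': "n = Suc n'" using \<open>n > 0\<close> by (cases n) auto
    have "x + d * (n' * (x div d)) = x mod d + n * (d * (x div d))"
      using mult_div_mod_eq[of d x] unfolding n' by (simp add: algebra_simps)
    then have "[x + d * (n' * (x div d)) = x mod d] (mod n)" by (simp add: cong_def)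
    then have "P (x mod d)" using per add \<open>P x\<close> mult by blast
    then show "d dvd x" using least[of "x mod d"] d by (metis dvd_eq_mod_eq_0 leD mod_less_divisor neq0_conv)
  qed (auto simp: mult elim!: dvdE)
  then show ?thesis using Pn by blast
qed

text \<open>By Bezout, \<open>x\<close> is a product of integer powers of \<open>x [^] k\<close> and
  \<open>x [^] l\<close>.\<close>

lemma (in subgroup) coprime_pow_mem:
  assumes "group G" "x \<in> carrier G" "x [^] k \<in> H" "x [^] l \<in> H" "coprime k (l :: nat)"
  shows "x \<in> H"
proof -
  interpret group G by fact
  have "coprime (int k) (int l)" using assms by simp
  then obtain u v where "u * int k + v * int l = 1" using bezout_int[of "int k" "int l"] by auto
  then have "x = x [^] (int k * u + int l * v)" using assms by (simp add: mult.commute)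
  also have "\<dots> = (x [^] k) [^] u \<otimes> (x [^] l) [^] v"
    using assms by (simp add: int_pow_mult int_pow_pow flip: int_pow_int)
  also have "\<dots> \<in> H"
    using assms by (intro subgroup.m_closed[OF subgroup_axioms] subgroup_int_pow_closed[OF subgroup_axioms])
  finally show ?thesis .
qed

section \<open>Groups with normal form \<open>b^i a^j\<close>\<close>

text \<open>The subgroup analysis uses only this arithmetic of normal forms, not the presentation.
  Exponents of \<open>b\<close> are natural numbers because they occur in \<open>r ^ k\<close> with
  \<open>r\<close> an integer.\<close>

locale split_metacyclic = group G for G (structure) +
  fixes m n :: nat and r :: int and e :: "nat \<Rightarrow> int \<Rightarrow> 'a"
  assumes m_pos: "m > 0" and n_pos: "n > 0" and r_pow: "[r ^ n = 1] (mod int m)"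
    and carrier_eq: "carrier G = {e i j | i j. True}"
    and e_mult: "e i j \<otimes> e k l = e (i + k) (j * r ^ k + l)"
    and e_eq_iff: "e i j = e k l \<longleftrightarrow> [i = k] (mod n) \<and> [j = l] (mod int m)"
begin

lemma e_closed [simp, intro]: "e i j \<in> carrier G"
  by (auto simp: carrier_eq)

lemma one_eq: "\<one> = e 0 0"
  using e_mult[of 0 0 0 0] by simp

lemma e_pow: "e i j [^] k = e (i * k) (j * gsum r i k)"
  by (induction k) (simp_all add: one_eq e_mult gsum_Suc algebra_simps)

lemma finite_carrier: "finite (carrier G)"
proof (rule finite_subset)
  show "carrier G \<subseteq> (\<lambda>(i, j). e i j) ` ({..<n} \<times> {0..<int m})"
  proof
    fix x assume "x \<in> carrier G"
    then obtain i j where "x = e i j" by (auto simp: carrier_eq)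
    also have "\<dots> = e (i mod n) (j mod int m)" by (simp add: e_eq_iff)
    finally show "x \<in> (\<lambda>(i, j). e i j) ` ({..<n} \<times> {0..<int m})"
      using m_pos n_pos by force
  qed
qed auto

text \<open>For admissible parameters this is \<open>\<langle>b\<^bsup>n1\<^esup> a\<^sup>s, a\<^bsup>m1\<^esup>\<rangle>\<close>, where \<open>e i j = b\<^sup>i a\<^sup>j\<close>.\<close>

definition sub :: "nat \<Rightarrow> nat \<Rightarrow> nat \<Rightarrow> 'a set"
  where "sub m1 n1 s = {e i j | i j. n1 dvd i \<and> int m1 dvd j - int s * gsum r n1 (i div n1)}"

text \<open>The last condition says that the power of \<open>b^n1 a^s\<close> with exponent
  \<open>n div n1\<close>, which is a power of \<open>a\<close>, is even a power of
  \<open>a^m1\<close>. The bound on \<open>s\<close> selects one representative modulo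
  \<open>m1\<close>.\<close>

definition admissible :: "nat \<Rightarrow> nat \<Rightarrow> nat \<Rightarrow> bool"
  where "admissible m1 n1 s \<longleftrightarrow> m1 dvd m \<and> n1 dvd n \<and> s < m1 \<and> int m1 dvd int s * geom_quot r n n1"

text \<open>Raising \<open>k\<close> by \<open>q = n div n1\<close> multiplies the sum by
  \<open>r ^ n\<close>, which is 1 modulo \<open>m1\<close>, and adds \<open>gsum r n1 q\<close>,
  which \<open>s\<close> annihilates modulo \<open>m1\<close>. Hence the condition in
  \<open>sub\<close> depends on the exponent of \<open>b\<close> only modulo
  \<open>n\<close>.\<close>

lemma gsum_cong:
  assumes "admissible m1 n1 s" "[n1 * k = n1 * l] (mod n)"
  shows "[int s * gsum r n1 k = int s * gsum r n1 l] (mod int m1)"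
proof -
  obtain q where q: "n = n1 * q" using assms by (auto simp: admissible_def)
  have n1: "n1 > 0" using n_pos q by auto
  have m1: "m1 dvd m" using assms by (simp add: admissible_def)
  have sq: "[int s * gsum r n1 q = 0] (mod int m1)"
    using assms(1) n1 unfolding admissible_def geom_quot_eq_gsum cong_0_iff by (simp add: q)
  have *: "[int s * gsum r n1 (x + q * t) = int s * gsum r n1 x] (mod int m1)" for x t
  proof (induction t)
    case (Suc t)
    have "[r ^ (n1 * q) = 1] (mod int m1)"
      using cong_dvd_modulus[OF r_pow, of "int m1"] m1 by (simp flip: q)
    then have "[int s * gsum r n1 (x + q * t) * r ^ (n1 * q) + int s * gsum r n1 q
        = int s * gsum r n1 x * 1 + 0] (mod int m1)"
      by (intro cong_add cong_mult Suc sq)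
    moreover have "gsum r n1 (x + q * Suc t) = gsum r n1 (x + q * t) * r ^ (n1 * q) + gsum r n1 q"
      using gsum_add[of r n1 "x + q * t" q] by (simp add: algebra_simps)
    ultimately show ?case by (simp add: algebra_simps)
  qed simp
  have "[k = l] (mod q)"
    using assms(2) n1 by (simp add: q cong_def mod_mult_mult1)
  \<comment> \<open>Either of \<open>k\<close> and \<open>l\<close> may be the larger, so both are
    raised by multiples of \<open>q\<close> to a common value.\<close>
  then obtain u v where "l + q * v = k + q * u"
    unfolding cong_iff_lin_nat by (auto simp: mult.commute)
  then show ?thesis using cong_trans[OF cong_sym[OF *[of k u]]] *[of l v] by simp
qed

text \<open>\<open>sub\<close> asserts the condition for some representatives of the exponents; by
  \<open>gsum_cong\<close> it can be tested on any.\<close>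

lemma mem_sub_iff:
  assumes "admissible m1 n1 s"
  shows "e i j \<in> sub m1 n1 s \<longleftrightarrow> n1 dvd i \<and> int m1 dvd j - int s * gsum r n1 (i div n1)"
proof
  assume "e i j \<in> sub m1 n1 s"
  then obtain i' j' where *: "[i = i'] (mod n)" "[j = j'] (mod int m)" "n1 dvd i'"
    "int m1 dvd j' - int s * gsum r n1 (i' div n1)"
    by (auto simp: sub_def e_eq_iff)
  have dvd: "m1 dvd m" "n1 dvd n" using assms by (auto simp: admissible_def)
  have i: "n1 dvd i" using cong_dvd_iff[OF cong_dvd_modulus_nat[OF *(1) dvd(2)]] *(3) by simp
  moreover have "[j = int s * gsum r n1 (i div n1)] (mod int m1)"
  proof -
    have "[j = j'] (mod int m1)" using cong_dvd_modulus[OF *(2), of "int m1"] dvd by simp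
    also have "[j' = int s * gsum r n1 (i' div n1)] (mod int m1)" using *(4) by (simp add: cong_iff_dvd_diff)
    also have "[int s * gsum r n1 (i' div n1) = int s * gsum r n1 (i div n1)] (mod int m1)"
      using *(1,3) i by (intro gsum_cong assms) (simp add: cong_sym)
    finally show ?thesis .
  qed
  ultimately show "n1 dvd i \<and> int m1 dvd j - int s * gsum r n1 (i div n1)"
    by (simp add: cong_iff_dvd_diff)
qed (auto simp: sub_def)

lemma subgroup_sub:
  assumes "admissible m1 n1 s"
  shows "subgroup (sub m1 n1 s) G"
proof (rule subgroupI)
  have n1: "n1 > 0" using assms n_pos by (auto simp: admissible_def intro: Nat.gr0I)
  show "sub m1 n1 s \<subseteq> carrier G" by (auto simp: sub_def)
  have "e 0 0 \<in> sub m1 n1 s" by (simp add: mem_sub_iff assms)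
  then show "sub m1 n1 s \<noteq> {}" by blast
  show mult: "x \<otimes> y \<in> sub m1 n1 s" if xy: "x \<in> sub m1 n1 s" "y \<in> sub m1 n1 s" for x y
  proof -
    obtain k j where x: "x = e (n1 * k) j" "int m1 dvd j - int s * gsum r n1 k"
      using xy(1) n1 by (auto simp: sub_def elim!: dvdE)
    obtain l j' where y: "y = e (n1 * l) j'" "int m1 dvd j' - int s * gsum r n1 l"
      using xy(2) n1 by (auto simp: sub_def elim!: dvdE)
    \<comment> \<open>Moving \<open>a^j\<close> past \<open>b^(n1 * l)\<close> multiplies its
      exponent by \<open>r ^ (n1 * l)\<close>, the same factor that appears in
      \<open>gsum_add\<close>.\<close>
    have "int m1 dvd (j - int s * gsum r n1 k) * r ^ (n1 * l) + (j' - int s * gsum r n1 l)"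
      using x y by (intro dvd_add dvd_mult2)
    also have "\<dots> = j * r ^ (n1 * l) + j' - int s * gsum r n1 (k + l)"
      by (simp add: gsum_add algebra_simps)
    finally have "e (n1 * (k + l)) (j * r ^ (n1 * l) + j') \<in> sub m1 n1 s"
      unfolding mem_sub_iff[OF assms] using n1 by simp
    then show ?thesis by (simp add: x y e_mult distrib_left)
  qed
  show "inv x \<in> sub m1 n1 s" if x: "x \<in> sub m1 n1 s" for x
  proof -
    have xc: "x \<in> carrier G" using x by (auto simp: sub_def)
    have pow: "x [^] Suc k \<in> sub m1 n1 s" for k
      by (induction k) (use x xc mult in simp_all)
    \<comment> \<open>With group order \<open>p + 1\<close>, the inverse is written as
      \<open>x^(2p+1)\<close> rather than \<open>x^p\<close>: the exponent is then positive even for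
      \<open>p = 0\<close>, so \<open>pow\<close> applies.\<close>
    obtain p where p: "order G = Suc p"
      using order_gt_0_iff_finite finite_carrier by (metis gr0_implies_Suc)
    have "x [^] Suc (p + p) \<otimes> x = x [^] Suc p \<otimes> x [^] Suc p"
      using xc by (simp only: nat_pow_mult nat_pow_Suc[symmetric] add_Suc add_Suc_right)
    also have "\<dots> = \<one>" using pow_order_eq_1[OF xc] unfolding p by (simp only: r_one one_closed)
    finally have "inv x = x [^] Suc (p + p)" using xc by (intro inv_equality) auto
    then show ?thesis using pow by simp
  qed
qed

lemma subgroup_nat_pow_closed:
  assumes "subgroup H G" "x \<in> H"
  shows "x [^] (k :: nat) \<in> H"
  using subgroup_int_pow_closed[OF assms, of "int k"] by (simp add: int_pow_int)

section \<open>Classification of the subgroups\<close>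

text \<open>The subgroup determines \<open>n1\<close> through the exponents of \<open>b\<close> that
  occur in it, \<open>m1\<close> through the powers of \<open>a\<close> it contains, and
  \<open>s\<close> modulo \<open>m1\<close> through the element \<open>e n1 (int s)\<close>.\<close>

lemma sub_inj:
  assumes adm: "admissible m1 n1 s" "admissible m2 n2 t" and eq: "sub m1 n1 s = sub m2 n2 t"
  shows "m1 = m2 \<and> n1 = n2 \<and> s = t"
proof -
  have n: "d dvd i \<longleftrightarrow> (\<exists>j. e i j \<in> sub k d u)" if "admissible k d u" for k d u i
    unfolding mem_sub_iff[OF that] by (metis diff_self dvd_0_right)
  have n_eq: "n1 = n2" using n[OF adm(1)] n[OF adm(2)] unfolding eq by (metis dvd_antisym dvd_refl)
  have "m1 dvd i \<longleftrightarrow> e 0 (int i) \<in> sub m1 n1 s" "m2 dvd i \<longleftrightarrow> e 0 (int i) \<in> sub m2 n2 t" for i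
    by (simp_all add: mem_sub_iff adm)
  then have m_eq: "m1 = m2" unfolding eq by (metis dvd_antisym dvd_refl)
  have "n1 > 0" using adm n_pos by (auto simp: admissible_def intro: Nat.gr0I)
  then have "e n1 (int s) \<in> sub m1 n1 s" by (simp add: mem_sub_iff adm gsum_def)
  then have "int m2 dvd int s - int t"
    using \<open>n1 > 0\<close> unfolding eq by (simp add: mem_sub_iff adm gsum_def n_eq)
  then have "[s = t] (mod m2)" by (simp add: cong_iff_dvd_diff flip: cong_int_iff)
  then have "s = t" using adm m_eq by (simp add: admissible_def cong_def)
  with n_eq m_eq show ?thesis by simp
qed

text \<open>\<open>H\<close> is determined separately over each exponent \<open>i\<close> of
  \<open>b\<close>: if \<open>n1\<close> divides \<open>i\<close>, a power of
  \<open>e n1 (int s)\<close> supplies one element, and the others differ from it by powers of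
  \<open>a^m1\<close>; otherwise there is none.\<close>

lemma subgroup_eq_sub:
  assumes H: "subgroup H G"
  obtains m1 n1 s where "admissible m1 n1 s" "H = sub m1 n1 s"
proof -
  interpret H: subgroup H G by fact
  have "\<exists>d. d dvd m \<and> (\<forall>i. e 0 (int i) \<in> H \<longleftrightarrow> d dvd i)"
  proof (rule periodic_add_closed_eq_multiples[OF m_pos])
    show "e 0 (int 0) \<in> H" using H.one_closed by (simp add: one_eq)
    show "e 0 (int (x + y)) \<in> H" if "e 0 (int x) \<in> H" "e 0 (int y) \<in> H" for x y
      using H.m_closed[OF that] by (simp add: e_mult)
    show "e 0 (int y) \<in> H" if "e 0 (int x) \<in> H" "[x = y] (mod m)" for x y
      using that e_eq_iff[of 0 "int x" 0 "int y"] by (simp add: cong_int_iff)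
  qed
  then obtain m1 where m1: "m1 dvd m" "e 0 (int i) \<in> H \<longleftrightarrow> m1 dvd i" for i by blast
  have "\<exists>d. d dvd n \<and> (\<forall>i. (\<exists>j. e i j \<in> H) \<longleftrightarrow> d dvd i)"
  proof (rule periodic_add_closed_eq_multiples[OF n_pos])
    show "\<exists>j. e 0 j \<in> H" using H.one_closed by (auto simp: one_eq)
    show "\<exists>j. e (x + y) j \<in> H" if xy: "\<exists>j. e x j \<in> H" "\<exists>j. e y j \<in> H" for x y
    proof -
      obtain j j' where "e x j \<in> H" "e y j' \<in> H" using xy by blast
      then have "e x j \<otimes> e y j' \<in> H" by (rule H.m_closed)
      then show ?thesis unfolding e_mult by blast
    qed
    show "\<exists>j. e y j \<in> H" if xy: "\<exists>j. e x j \<in> H" "[x = y] (mod n)" for x y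
    proof -
      obtain j where "e x j \<in> H" using xy by blast
      moreover have "e x j = e y j" using xy by (simp add: e_eq_iff)
      ultimately show ?thesis by auto
    qed
  qed
  then obtain n1 where n1: "n1 dvd n" "(\<exists>j. e i j \<in> H) \<longleftrightarrow> n1 dvd i" for i by blast
  have pos: "m1 > 0" "n1 > 0" using m1 n1 m_pos n_pos by (auto intro: Nat.gr0I)
  have m1_int: "e 0 j \<in> H \<longleftrightarrow> int m1 dvd j" for j
  proof -
    \<comment> \<open>The description of \<open>m1\<close> covers natural exponents only; an integer
      exponent is replaced by its residue modulo \<open>m\<close>.\<close>
    define i where "i = nat (j mod int m)"
    have "[j = int i] (mod int m)" using m_pos by (simp add: i_def)
    then have "e 0 j = e 0 (int i)" by (simp add: e_eq_iff)
    then have "e 0 j \<in> H \<longleftrightarrow> int m1 dvd int i" using m1 by simp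
    also have "\<dots> \<longleftrightarrow> int m1 dvd j"
      using cong_dvd_iff[OF cong_dvd_modulus[OF \<open>[j = int i] (mod int m)\<close>, of "int m1"]] m1(1) by simp
    finally show ?thesis .
  qed
  \<comment> \<open>The elements of \<open>H\<close> over a fixed exponent of \<open>b\<close> form
    a left coset of the intersection of \<open>H\<close> with the powers of
    \<open>a\<close>.\<close>
  have shift: "e i (j + j') \<in> H \<longleftrightarrow> int m1 dvd j'" if "e i j \<in> H" for i j j'
  proof -
    have e: "e i j \<otimes> e 0 j' = e i (j + j')" by (simp add: e_mult)
    have "e i (j + j') \<in> H \<longleftrightarrow> e 0 j' \<in> H"
    proof
      assume "e i (j + j') \<in> H"
      then have "inv (e i j) \<otimes> (e i j \<otimes> e 0 j') \<in> H"
        unfolding e by (intro H.m_closed H.m_inv_closed that)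
      then show "e 0 j' \<in> H" by (simp flip: m_assoc)
    next
      assume "e 0 j' \<in> H"
      then show "e i (j + j') \<in> H" unfolding e[symmetric] by (intro H.m_closed that)
    qed
    then show ?thesis by (simp add: m1_int)
  qed
  obtain s0 where s0: "e n1 s0 \<in> H" using n1(2)[of n1] by auto
  define s where "s = nat (s0 mod int m1)"
  have s: "int s = s0 mod int m1" "s < m1" using pos by (simp_all add: s_def nat_less_iff)
  have "int m1 dvd int s - s0" by (rule mod_eq_dvd_iff[THEN iffD1]) (simp add: s(1))
  then have "e n1 (int s) \<in> H" using shift[OF s0, of "int s - s0"] by simp
  then have "e n1 (int s) [^] k \<in> H" for k :: nat by (rule subgroup_nat_pow_closed[OF H])
  then have pow: "e (n1 * k) (int s * gsum r n1 k) \<in> H" for k by (simp add: e_pow)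
  \<comment> \<open>The power with exponent \<open>n div n1\<close> has \<open>b\<close>-exponent
    \<open>n\<close>, so it is a power of \<open>a\<close> in \<open>H\<close>; this forces the
    congruence in \<open>admissible\<close>.\<close>
  have "e n (int s * geom_quot r n n1) \<in> H"
    using pow[of "n div n1"] n1(1) by (simp add: geom_quot_eq_gsum)
  moreover have "e n j = e 0 j" for j by (simp add: e_eq_iff cong_def)
  ultimately have "int m1 dvd int s * geom_quot r n n1" by (simp add: m1_int)
  then have adm: "admissible m1 n1 s" using m1(1) n1(1) s(2) by (simp add: admissible_def)
  have "e i j \<in> H \<longleftrightarrow> e i j \<in> sub m1 n1 s" for i j
  proof (cases "n1 dvd i")
    case True
    then show ?thesis
      using shift[OF pow, of "i div n1" "j - int s * gsum r n1 (i div n1)"] by (simp add: mem_sub_iff adm)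
  next
    case False
    then show ?thesis using n1(2)[of i] by (auto simp: mem_sub_iff adm)
  qed
  then have "x \<in> H \<longleftrightarrow> x \<in> sub m1 n1 s" if "x \<in> carrier G" for x
    using that by (auto simp: carrier_eq)
  then have "H = sub m1 n1 s"
    using H.subset subgroup.subset[OF subgroup_sub[OF adm]] by blast
  with adm show thesis by (rule that)
qed

section \<open>Cyclic subgroups\<close>

text \<open>The divisibility says exactly that the generators \<open>?x\<close> and
  \<open>?z\<close> commute, which is necessary for cyclicity. Conversely, if they commute,
  coprimality of \<open>m\<close> and \<open>n\<close> lets a single element generate both.\<close>

lemma cyclic_sub_iff:
  assumes cop: "coprime m n" and adm: "admissible m1 n1 s"
  shows "cyclic_group (G\<lparr>carrier := sub m1 n1 s\<rparr>) \<longleftrightarrow> int (m div m1) dvd r ^ n1 - 1"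
proof -
  let ?H = "sub m1 n1 s"
  let ?x = "e n1 (int s)" and ?z = "e 0 (int m1)"
  have H: "subgroup ?H G" by (rule subgroup_sub[OF adm])
  obtain u where u: "m = m1 * u" using adm by (auto simp: admissible_def)
  have pos: "m1 > 0" "n1 > 0"
    using adm m_pos n_pos by (auto simp: admissible_def intro: Nat.gr0I)
  have mem: "?x \<in> ?H" "?z \<in> ?H" using pos by (simp_all add: mem_sub_iff adm gsum_def)
  have "?z \<otimes> ?x = ?x \<otimes> ?z \<longleftrightarrow> int m dvd int m1 * r ^ n1 - int m1"
    by (simp add: e_mult e_eq_iff cong_iff_dvd_diff)
  also have "\<dots> \<longleftrightarrow> int m1 * int u dvd int m1 * (r ^ n1 - 1)" by (simp add: u algebra_simps)
  also have "\<dots> \<longleftrightarrow> int (m div m1) dvd r ^ n1 - 1" using pos by (simp add: u)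
  finally have comm_iff: "?z \<otimes> ?x = ?x \<otimes> ?z \<longleftrightarrow> int (m div m1) dvd r ^ n1 - 1" .
  show ?thesis
  proof
    assume "cyclic_group (G\<lparr>carrier := ?H\<rparr>)"
    then interpret C: comm_group "G\<lparr>carrier := ?H\<rparr>"
      by (intro group.cyclic_imp_abelian_group subgroup_imp_group H)
    have "?z \<otimes> ?x = ?x \<otimes> ?z" using C.m_comm mem by simp
    then show "int (m div m1) dvd r ^ n1 - 1" by (simp add: comm_iff)
  next
    assume "int (m div m1) dvd r ^ n1 - 1"
    then have comm: "?z \<otimes> ?x = ?x \<otimes> ?z" by (simp add: comm_iff)
    \<comment> \<open>Since \<open>?x [^] n\<close> is a power of \<open>a\<close>,
      \<open>?x [^] (m * n)\<close> is trivial. Hence the \<open>n\<close>-th power of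
      \<open>g\<close> is \<open>?z [^] n\<close>, and together with
      \<open>?z [^] m = \<one>\<close> this recovers \<open>?z\<close>.\<close>
    define g where "g = ?x [^] m \<otimes> ?z"
    have gH: "g \<in> ?H"
      unfolding g_def using mem H by (intro subgroup.m_closed[OF H] subgroup_nat_pow_closed)
    have gc [simp]: "g \<in> carrier G" by (simp add: g_def)
    define K where "K = generate G {g}"
    have K: "subgroup K G" unfolding K_def by (rule generate_is_subgroup) simp
    have gK: "g \<in> K" by (simp add: K_def generate.incl)
    have xn: "?x [^] n = e 0 (int s * gsum r n1 n)"
      by (simp add: e_pow e_eq_iff cong_def)
    have zm: "?z [^] m = \<one>" by (simp add: e_pow one_eq e_eq_iff cong_def gsum_def)
    have "g [^] n = ?x [^] (m * n) \<otimes> ?z [^] n"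
    proof -
      have "?x [^] m \<otimes> ?z = ?z \<otimes> ?x [^] m"
        by (rule group_commutes_pow) (simp_all add: comm)
      then have "g [^] n = (?x [^] m) [^] n \<otimes> ?z [^] n"
        unfolding g_def by (rule pow_mult_distrib) simp_all
      then show ?thesis by (simp add: nat_pow_pow)
    qed
    also have "?x [^] (m * n) = (?x [^] n) [^] m" by (simp add: nat_pow_pow mult.commute)
    also have "\<dots> = \<one>" unfolding xn by (simp add: e_pow one_eq e_eq_iff cong_def gsum_def)
    finally have zn: "?z [^] n = g [^] n" by simp
    interpret K: subgroup K G by (rule K)
    have zK: "?z \<in> K"
      by (rule K.coprime_pow_mem[OF is_group _ _ _ cop])
        (use gK in \<open>auto simp: zm zn intro: subgroup_nat_pow_closed[OF K]\<close>)
    have zjK: "e 0 j \<in> K" if j: "int m1 dvd j" for j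
    proof -
      obtain t where t: "j = int m1 * t" using j by blast
      have "?z [^] nat (t mod int m) \<in> K" using zK by (rule subgroup_nat_pow_closed[OF K])
      also have "?z [^] nat (t mod int m) = e 0 j"
        using m_pos by (simp add: e_pow e_eq_iff gsum_def t cong_def mod_mult_right_eq)
      finally show ?thesis .
    qed
    have "?x [^] m = g \<otimes> inv ?z" by (simp add: g_def m_assoc)
    then have xmK: "?x [^] m \<in> K" using gK zK by simp
    have "?x [^] n \<in> ?H" using mem H by (intro subgroup_nat_pow_closed)
    \<comment> \<open>\<open>?x [^] n\<close> is a power of \<open>a\<close> lying in
      \<open>?H\<close>, hence a power of \<open>?z\<close>.\<close>
    then have xnK: "?x [^] n \<in> K" unfolding xn by (intro zjK) (simp add: mem_sub_iff adm)
    have xK: "?x \<in> K" by (rule K.coprime_pow_mem[OF is_group e_closed xmK xnK cop])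
    have "?H \<subseteq> K"
    proof
      fix y assume "y \<in> ?H"
      then obtain k j where y: "y = e (n1 * k) j" "int m1 dvd j - int s * gsum r n1 k"
        using pos by (auto simp: sub_def elim!: dvdE)
      have "y = ?x [^] k \<otimes> e 0 (j - int s * gsum r n1 k)"
        by (simp add: y e_pow e_mult)
      then show "y \<in> K" using xK zjK[OF y(2)] subgroup_nat_pow_closed[OF K] by simp
    qed
    moreover have "K \<subseteq> ?H" unfolding K_def using gH H by (intro generate_subgroup_incl) auto
    ultimately have "?H = K" by blast
    then have "G\<lparr>carrier := ?H\<rparr> = subgroup_generated G {g}"
      by (simp add: subgroup_generated_def K_def)
    then show "cyclic_group (G\<lparr>carrier := ?H\<rparr>)" by (simp add: cyclic_group_generated)
  qed
qed

section \<open>Counting subgroups\<close>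

text \<open>The triples \<open>(m1, n1, s)\<close> parametrize the subgroups bijectively. The
  predicate \<open>P\<close> lets one count serve both for all subgroups and for the cyclic
  ones.\<close>

lemma card_subgroups:
  "int (card {H. subgroup H G \<and> P H}) =
    (\<Sum>m1 | m1 dvd m. \<Sum>n1 | n1 dvd n. int (card {s. s < m1 \<and> int m1 dvd int s * geom_quot r n n1 \<and> P (sub m1 n1 s)}))"
proof -
  let ?A = "\<lambda>m1 n1. {s. s < m1 \<and> int m1 dvd int s * geom_quot r n n1 \<and> P (sub m1 n1 s)}"
  let ?T = "SIGMA m1:{d. d dvd m}. SIGMA n1:{d. d dvd n}. ?A m1 n1"
  let ?f = "\<lambda>(m1, n1, s). sub m1 n1 s"
  have T: "(m1, n1, s) \<in> ?T \<longleftrightarrow> admissible m1 n1 s \<and> P (sub m1 n1 s)" for m1 n1 s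
    by (auto simp: admissible_def)
  have "inj_on ?f ?T"
  proof (rule inj_onI)
    fix x y assume xy: "x \<in> ?T" "y \<in> ?T" "?f x = ?f y"
    obtain m1 n1 s m2 n2 t where *: "x = (m1, n1, s)" "y = (m2, n2, t)" by (metis prod_cases3)
    have "admissible m1 n1 s" "admissible m2 n2 t" using xy(1,2) unfolding * T by simp_all
    then show "x = y" using sub_inj xy(3) unfolding * by simp
  qed
  moreover have "?f ` ?T = {H. subgroup H G \<and> P H}"
  proof (intro equalityI subsetI)
    fix H assume "H \<in> {H. subgroup H G \<and> P H}"
    then obtain m1 n1 s where *: "admissible m1 n1 s" "H = sub m1 n1 s" "P H"
      by (auto elim: subgroup_eq_sub)
    then have "(m1, n1, s) \<in> ?T" unfolding T by simp
    then show "H \<in> ?f ` ?T" using *(2) image_eqI[of H ?f "(m1, n1, s)" ?T] by simp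
  next
    fix H assume "H \<in> ?f ` ?T"
    then obtain m1 n1 s where "(m1, n1, s) \<in> ?T" "H = sub m1 n1 s" by auto
    then show "H \<in> {H. subgroup H G \<and> P H}" unfolding T by (simp add: subgroup_sub)
  qed
  ultimately have "card {H. subgroup H G \<and> P H} = card ?T" using card_image[of ?f ?T] by simp
  also have "\<dots> = (\<Sum>m1 | m1 dvd m. card (SIGMA n1:{d. d dvd n}. ?A m1 n1))"
    using m_pos n_pos by (intro card_SigmaI ballI finite_SigmaI) simp_all
  also have "\<dots> = (\<Sum>m1 | m1 dvd m. \<Sum>n1 | n1 dvd n. card (?A m1 n1))"
    using n_pos by (intro sum.cong HOL.refl card_SigmaI ballI) simp_all
  finally show ?thesis by simp
qed

lemma card_subgroups_of:
  "int (card (subgroups_of G)) = (\<Sum>m1 | m1 dvd m. \<Sum>n1 | n1 dvd n. gcd (int m1) (geom_quot r n n1))"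
proof -
  have "card {s. s < m1 \<and> int m1 dvd int s * geom_quot r n n1} = gcd (int m1) (geom_quot r n n1)"
    if "m1 dvd m" for m1 n1
    by (rule card_dvd_mult_eq_gcd) (use that m_pos in \<open>auto intro: Nat.gr0I\<close>)
  then show ?thesis using card_subgroups[of "\<lambda>_. True"] by (simp add: subgroups_of_def)
qed

text \<open>Cyclicity of \<open>sub m1 n1 s\<close> does not depend on \<open>s\<close>, so each
  pair \<open>(m1, n1)\<close> contributes either its full gcd or nothing.\<close>

lemma card_cyclic_subgroups_of:
  assumes "coprime m n"
  shows "int (card (cyclic_subgroups_of G)) =
    (\<Sum>m1 | m1 dvd m. \<Sum>n1 | n1 dvd n \<and> int (m div m1) dvd r ^ n1 - 1. gcd (int m1) (geom_quot r n n1))"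
proof -
  have *: "int (card {s. s < m1 \<and> int m1 dvd int s * geom_quot r n n1 \<and> cyclic_group (G\<lparr>carrier := sub m1 n1 s\<rparr>)})
      = (if int (m div m1) dvd r ^ n1 - 1 then gcd (int m1) (geom_quot r n n1) else 0)"
    if dvd: "m1 dvd m" "n1 dvd n" for m1 n1
  proof -
    have "{s. s < m1 \<and> int m1 dvd int s * geom_quot r n n1 \<and> cyclic_group (G\<lparr>carrier := sub m1 n1 s\<rparr>)}
        = (if int (m div m1) dvd r ^ n1 - 1 then {s. s < m1 \<and> int m1 dvd int s * geom_quot r n n1} else {})"
      using cyclic_sub_iff[OF assms] dvd by (auto simp: admissible_def)
    moreover have "m1 > 0" using dvd m_pos by (auto intro: Nat.gr0I)
    ultimately show ?thesis by (simp add: card_dvd_mult_eq_gcd)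
  qed
  have fin: "finite {d. d dvd n}" using n_pos by simp
  have filter: "(\<Sum>d | d dvd n \<and> Q d. f d) = (\<Sum>d | d dvd n. if Q d then f d else 0)" for Q and f :: "nat \<Rightarrow> int"
    using sum.inter_filter[OF fin, of f Q] by simp
  show ?thesis
    unfolding cyclic_subgroups_of_def card_subgroups filter
    by (rule sum.cong[OF HOL.refl], rule sum.cong[OF HOL.refl]) (simp add: *)
qed

end

section \<open>Words, generators and conjugation\<close>

lemma word_eval_word_pow:
  assumes "group G" "f g \<in> carrier G"
  shows "word_eval G f (word_pow g k) = f g [^]\<^bsub>G\<^esub> k"
proof -
  interpret group G by fact
  have *: "word_eval G f (replicate i (g, e)) = (if e then f g else inv\<^bsub>G\<^esub> f g) [^]\<^bsub>G\<^esub> i" for i e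
  proof (induction i)
    case (Suc i)
    show ?case
      using assms(2) nat_pow_Suc2[of "f g" i] nat_pow_Suc2[of "inv\<^bsub>G\<^esub> f g" i] by (simp add: Suc.IH)
  qed simp
  show ?thesis
  proof (cases "k \<ge> 0")
    case True
    then show ?thesis by (simp add: word_pow_def * flip: int_pow_int)
  next
    case False
    then have "f g [^]\<^bsub>G\<^esub> k = f g [^]\<^bsub>G\<^esub> (- int (nat (- k)))" by simp
    also have "\<dots> = inv\<^bsub>G\<^esub> f g [^]\<^bsub>G\<^esub> nat (- k)"
      using assms(2) by (simp only: int_pow_neg_int nat_pow_inv)
    finally show ?thesis using False by (simp add: word_pow_def *)
  qed
qed

text \<open>Turns a class of words into a product of generators, so that relations between words
  become equations in the group.\<close>

lemma word_class_eq_word_eval: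
  "word_class R u = word_eval (presented_group R) (\<lambda>g. word_class R [(g, True)]) u"
proof (induction u)
  case Nil
  show ?case by (simp add: one_presented_group)
next
  case (Cons x u)
  interpret group "presented_group R" by (rule group_presented_group)
  obtain g e where x: "x = (g, e)" by (cases x)
  have "word_class R [(g, False)] \<otimes>\<^bsub>presented_group R\<^esub> word_class R [(g, True)] = \<one>\<^bsub>presented_group R\<^esub>"
    using word_eq.cancel[of R g False]
    by (simp add: mult_presented_group one_presented_group word_class_eq_iff)
  then have "inv\<^bsub>presented_group R\<^esub> word_class R [(g, True)] = word_class R [(g, False)]"
    by (intro inv_equality) (simp_all add: carrier_presented_group)
  then have "word_class R [x] = (if e then word_class R [(g, True)] else inv\<^bsub>presented_group R\<^esub> word_class R [(g, True)])"
    by (simp add: x)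
  then show ?case
    using mult_presented_group[of R "[x]" u] by (cases e) (simp_all add: Cons.IH x)
qed

text \<open>Conjugation by \<open>b\<close> is an endomorphism taking \<open>a\<close> to its
  \<open>r\<close>-th power, hence it multiplies every integer exponent of \<open>a\<close> by
  \<open>r\<close>; this is iterated \<open>k\<close> times.\<close>

lemma (in group) conj_int_pow:
  assumes "a \<in> carrier G" "b \<in> carrier G" "a \<otimes> b = b \<otimes> a [^] (r :: int)"
  shows "a [^] (j :: int) \<otimes> b [^] (k :: nat) = b [^] k \<otimes> a [^] (j * r ^ k)"
proof (induction k)
  case 0
  show ?case using assms by simp
next
  case (Suc k)
  have *: "a [^] i \<otimes> b = b \<otimes> a [^] (i * r)" for i :: int
  proof -
    define c where "c x = inv b \<otimes> x \<otimes> b" for x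
    have "c \<in> hom G G"
    proof (rule homI)
      fix x y assume "x \<in> carrier G" "y \<in> carrier G"
      moreover from this have "b \<otimes> (inv b \<otimes> (y \<otimes> b)) = y \<otimes> b"
        using assms by (simp flip: m_assoc)
      ultimately show "c (x \<otimes> y) = c x \<otimes> c y" using assms by (simp add: c_def m_assoc)
    qed (use assms in \<open>simp add: c_def\<close>)
    then have "c (a [^] i) = c a [^] i" using assms by (intro hom_int_pow is_group)
    also have "c a = a [^] r"
      using assms by (simp add: c_def m_assoc) (simp flip: m_assoc)
    also have "(a [^] r) [^] i = a [^] (i * r)" using assms by (simp add: int_pow_pow mult.commute)
    finally have "b \<otimes> (inv b \<otimes> a [^] i \<otimes> b) = b \<otimes> a [^] (i * r)" by (simp add: c_def)
    moreover have "b \<otimes> (inv b \<otimes> a [^] i \<otimes> b) = a [^] i \<otimes> b" using assms by (simp flip: m_assoc)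
    ultimately show ?thesis by simp
  qed
  have "a [^] j \<otimes> b [^] Suc k = b [^] k \<otimes> a [^] (j * r ^ k) \<otimes> b"
    using assms by (simp add: Suc.IH flip: m_assoc)
  also have "\<dots> = b [^] Suc k \<otimes> a [^] (j * r ^ Suc k)"
    using assms by (simp add: m_assoc * mult_ac)
  finally show ?case .
qed

section \<open>The semidirect product of residues\<close>

locale zm_parameters =
  fixes m n :: nat and r :: int
  assumes m_pos: "m > 0" and n_pos: "n > 0" and r_pow: "[r ^ n = 1] (mod int m)"
begin

definition nf :: "nat \<Rightarrow> int \<Rightarrow> nat \<times> int"
  where "nf i j = (i mod n, j mod int m)"

definition model :: "(nat \<times> int) monoid"
  where "model = \<lparr>carrier = {nf i j | i j. True},
    monoid.mult = (\<lambda>x y. nf (fst x + fst y) (snd x * r ^ fst y + snd y)),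
    monoid.one = nf 0 0\<rparr>"

lemma nf_eq_iff: "nf i j = nf k l \<longleftrightarrow> [i = k] (mod n) \<and> [j = l] (mod int m)"
  by (simp add: nf_def cong_def)

lemma nf_closed [simp]: "nf i j \<in> carrier model"
  by (auto simp: model_def)

lemma carrier_modelE:
  assumes "x \<in> carrier model"
  obtains i j where "x = nf i j"
  using assms by (auto simp: model_def)

lemma one_model: "\<one>\<^bsub>model\<^esub> = nf 0 0"
  by (simp add: model_def)

lemma nf_mult: "nf i j \<otimes>\<^bsub>model\<^esub> nf k l = nf (i + k) (j * r ^ k + l)"
proof -
  \<comment> \<open>Reducing \<open>k\<close> modulo \<open>n\<close> leaves the twist unchanged
    modulo \<open>m\<close>, because \<open>r ^ n\<close> is 1 there.\<close>
  have "[r ^ (k mod n) = r ^ (k mod n) * (r ^ n) ^ (k div n)] (mod int m)"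
    using cong_mult[OF cong_refl cong_pow[OF r_pow, of "k div n"], of "r ^ (k mod n)"]
    by (simp add: cong_sym_eq)
  also have "r ^ (k mod n) * (r ^ n) ^ (k div n) = r ^ k"
    by (simp flip: power_add power_mult)
  finally have "[j mod int m * r ^ (k mod n) + l mod int m = j * r ^ k + l] (mod int m)"
    by (intro cong_add cong_mult) simp_all
  then have "nf (i mod n + k mod n) (j mod int m * r ^ (k mod n) + l mod int m) = nf (i + k) (j * r ^ k + l)"
    unfolding nf_eq_iff by (simp add: cong_def mod_add_eq)
  then show ?thesis by (simp add: model_def nf_def)
qed

text \<open>With natural exponents, \<open>(n - 1) * i\<close> takes the place of \<open>-i\<close>
  modulo \<open>n\<close>.\<close>

lemma nf_mult_inverse: "nf ((n - 1) * i) (- j * r ^ ((n - 1) * i)) \<otimes>\<^bsub>model\<^esub> nf i j = \<one>\<^bsub>model\<^esub>"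
proof -
  have *: "(n - 1) * i + i = n * i" using n_pos by (cases n) auto
  then have "r ^ ((n - 1) * i) * r ^ i = (r ^ n) ^ i" by (simp flip: power_add power_mult)
  then have "nf ((n - 1) * i) (- j * r ^ ((n - 1) * i)) \<otimes>\<^bsub>model\<^esub> nf i j = nf (n * i) (- j * (r ^ n) ^ i + j)"
    by (simp add: nf_mult * mult.assoc del: One_nat_def)
  also have "[- j * (r ^ n) ^ i + j = - j * 1 ^ i + j] (mod int m)"
    by (intro cong_add cong_mult cong_refl cong_pow r_pow)
  then have "nf (n * i) (- j * (r ^ n) ^ i + j) = nf 0 0"
    by (simp add: nf_eq_iff cong_def)
  finally show ?thesis by (simp add: one_model)
qed

lemma group_model: "group model"
proof (rule groupI)
  show "x \<otimes>\<^bsub>model\<^esub> y \<in> carrier model" if "x \<in> carrier model" "y \<in> carrier model" for x y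
    using that by (auto elim!: carrier_modelE simp: nf_mult)
  show "x \<otimes>\<^bsub>model\<^esub> y \<otimes>\<^bsub>model\<^esub> z = x \<otimes>\<^bsub>model\<^esub> (y \<otimes>\<^bsub>model\<^esub> z)"
    if "x \<in> carrier model" "y \<in> carrier model" "z \<in> carrier model" for x y z
    using that by (auto elim!: carrier_modelE simp: nf_mult power_add algebra_simps)
  show "\<one>\<^bsub>model\<^esub> \<otimes>\<^bsub>model\<^esub> x = x" if "x \<in> carrier model" for x
    using that by (auto elim!: carrier_modelE simp: nf_mult one_model)
  show "\<exists>y\<in>carrier model. y \<otimes>\<^bsub>model\<^esub> x = \<one>\<^bsub>model\<^esub>" if "x \<in> carrier model" for x
    using that by (auto elim!: carrier_modelE intro: nf_mult_inverse)
qed (simp add: one_model)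

sublocale model: group model
  by (rule group_model)

lemma nf_pow_a: "nf 0 1 [^]\<^bsub>model\<^esub> (j :: int) = nf 0 j"
proof -
  have nat: "nf 0 1 [^]\<^bsub>model\<^esub> (k :: nat) = nf 0 (int k)" for k
    by (induction k) (simp_all add: one_model nf_mult add.commute)
  have "inv\<^bsub>model\<^esub> nf 0 k = nf 0 (- k)" for k
    by (rule model.inv_equality) (simp_all add: nf_mult one_model)
  then show ?thesis by (simp add: int_pow_def2 nat)
qed

lemma nf_pow_b: "nf 1 0 [^]\<^bsub>model\<^esub> (i :: nat) = nf i 0"
  by (induction i) (simp_all add: one_model nf_mult)

section \<open>Normal form in the presented group\<close>

abbreviation G where "G \<equiv> ZM m n r"

definition rels :: "(zm_gen word \<times> zm_gen word) set"
  where "rels = {(word_pow gen_a (int m), []), (word_pow gen_b (int n), []),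
     (word_pow gen_b (-1) @ word_pow gen_a 1 @ word_pow gen_b 1, word_pow gen_a r)}"

lemma ZM_eq: "G = presented_group rels"
  by (simp add: ZM_def rels_def)

sublocale group G
  unfolding ZM_eq by (rule group_presented_group)

definition gen :: "zm_gen \<Rightarrow> zm_gen word set"
  where "gen g = word_class rels [(g, True)]"

abbreviation a where "a \<equiv> gen gen_a"
abbreviation b where "b \<equiv> gen gen_b"

lemma gen_closed [simp]: "gen g \<in> carrier G"
  by (simp add: gen_def ZM_eq carrier_presented_group)

lemma word_class_eq_eval_gen: "word_class rels u = word_eval G gen u"
  unfolding ZM_eq gen_def by (rule word_class_eq_word_eval)

lemma word_eval_rel:
  assumes "(u, v) \<in> rels"
  shows "word_eval G gen u = word_eval G gen v"
  using word_eq.rel[OF assms] by (simp add: word_class_eq_iff flip: word_class_eq_eval_gen)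

lemma a_pow_m: "a [^]\<^bsub>G\<^esub> m = \<one>\<^bsub>G\<^esub>"
  using word_eval_rel[of "word_pow gen_a (int m)" "[]"]
  by (simp add: rels_def word_eval_word_pow[OF is_group] int_pow_int)

lemma b_pow_n: "b [^]\<^bsub>G\<^esub> n = \<one>\<^bsub>G\<^esub>"
  using word_eval_rel[of "word_pow gen_b (int n)" "[]"]
  by (simp add: rels_def word_eval_word_pow[OF is_group] int_pow_int)

lemma a_mult_b: "a \<otimes>\<^bsub>G\<^esub> b = b \<otimes>\<^bsub>G\<^esub> a [^]\<^bsub>G\<^esub> r"
proof -
  have "inv\<^bsub>G\<^esub> b \<otimes>\<^bsub>G\<^esub> (a \<otimes>\<^bsub>G\<^esub> b) = a [^]\<^bsub>G\<^esub> r"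
    using word_eval_rel[of "word_pow gen_b (-1) @ word_pow gen_a 1 @ word_pow gen_b 1" "word_pow gen_a r"]
    by (simp add: rels_def word_eval_word_pow[OF is_group] word_eval_append[OF is_group] int_pow_neg)
  then show ?thesis by (metis gen_closed inv_solve_left' m_closed int_pow_closed)
qed

definition elt :: "nat \<Rightarrow> int \<Rightarrow> zm_gen word set"
  where "elt i j = b [^]\<^bsub>G\<^esub> i \<otimes>\<^bsub>G\<^esub> a [^]\<^bsub>G\<^esub> j"

lemma elt_mult: "elt i j \<otimes>\<^bsub>G\<^esub> elt k l = elt (i + k) (j * r ^ k + l)"
proof -
  have "elt i j \<otimes>\<^bsub>G\<^esub> elt k l = b [^]\<^bsub>G\<^esub> i \<otimes>\<^bsub>G\<^esub> (a [^]\<^bsub>G\<^esub> j \<otimes>\<^bsub>G\<^esub> b [^]\<^bsub>G\<^esub> k) \<otimes>\<^bsub>G\<^esub> a [^]\<^bsub>G\<^esub> l"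
    by (simp add: elt_def m_assoc)
  also have "\<dots> = (b [^]\<^bsub>G\<^esub> i \<otimes>\<^bsub>G\<^esub> b [^]\<^bsub>G\<^esub> k) \<otimes>\<^bsub>G\<^esub> (a [^]\<^bsub>G\<^esub> (j * r ^ k) \<otimes>\<^bsub>G\<^esub> a [^]\<^bsub>G\<^esub> l)"
    by (simp add: conj_int_pow[OF _ _ a_mult_b] m_assoc)
  finally show ?thesis by (simp add: elt_def nat_pow_mult int_pow_mult)
qed

text \<open>Every letter and its inverse has the form \<open>elt i j\<close>, and
  \<open>elt_mult\<close> keeps products in this form.\<close>

lemma carrier_eq_elt: "carrier G = {elt i j | i j. True}"
proof (intro equalityI subsetI)
  fix x assume "x \<in> carrier G"
  then obtain u where "x = word_class rels u" by (auto simp: ZM_eq carrier_presented_group)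
  then have "x = word_eval G gen u" by (simp add: word_class_eq_eval_gen)
  moreover have "\<exists>i j. word_eval G gen u = elt i j"
  proof (induction u)
    case Nil
    have "\<one>\<^bsub>G\<^esub> = elt 0 0" by (simp add: elt_def)
    then show ?case by auto
  next
    case (Cons x u)
    have "inv\<^bsub>G\<^esub> b = b [^]\<^bsub>G\<^esub> (n - 1)"
      using b_pow_n n_pos nat_pow_Suc[of b "n - 1"] by (intro inv_equality) simp_all
    then have "inv\<^bsub>G\<^esub> b = elt (n - 1) 0" by (simp add: elt_def)
    moreover have "b = elt 1 0" "a = elt 0 1" "inv\<^bsub>G\<^esub> a = elt 0 (-1)"
      by (simp_all add: elt_def int_pow_neg)
    moreover have "gen g = a \<or> gen g = b" for g by (cases g) auto
    ultimately have "\<exists>i j. (if snd x then gen (fst x) else inv\<^bsub>G\<^esub> gen (fst x)) = elt i j" by metis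
    with Cons show ?case by (force simp: elt_mult)
  qed
  ultimately show "x \<in> {elt i j | i j. True}" by auto
qed (auto simp: elt_def)

text \<open>The generators of \<open>model\<close> satisfy the relations, so the universal property
  gives a homomorphism sending \<open>elt i j\<close> to \<open>nf i j\<close>.\<close>

lemma elt_inj:
  assumes "elt i j = elt k l"
  shows "nf i j = nf k l"
proof -
  define f where "f = case_zm_gen (nf 0 1) (nf 1 0)"
  have f [simp]: "f g \<in> carrier model" for g by (cases g) (simp_all add: f_def)
  have fab: "f gen_a = nf 0 1" "f gen_b = nf 1 0" by (simp_all add: f_def)
  have inv_b: "inv\<^bsub>model\<^esub> nf 1 0 = nf (n - 1) 0"
    using n_pos by (intro model.inv_equality) (simp_all add: nf_mult one_model nf_eq_iff cong_def)
  have nat_pow_a: "nf 0 1 [^]\<^bsub>model\<^esub> k = nf 0 (int k)" for k :: nat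
    using nf_pow_a[of "int k"] by (simp add: int_pow_int)
  \<comment> \<open>In the conjugation relation the \<open>b\<close>-exponents \<open>n - 1\<close>
    and 1 add up to 0 modulo \<open>n\<close>, while the twist turns the \<open>a\<close>-exponent 1
    into \<open>r\<close>.\<close>
  have "word_eval model f u = word_eval model f v" if "(u, v) \<in> rels" for u v
    using that n_pos
    by (auto simp: rels_def word_eval_word_pow[OF group_model] word_eval_append[OF group_model]
        fab nf_pow_a nat_pow_a nf_pow_b int_pow_int model.int_pow_neg inv_b one_model nf_mult nf_eq_iff cong_def
        simp del: One_nat_def)
  from presented_group_universal[OF group_model f this]
  obtain h where h: "h \<in> hom G model" "\<And>g. h (gen g) = f g"
    by (auto simp: ZM_eq gen_def)
  interpret h: group_hom G model h
    by (simp add: group_hom_def group_hom_axioms_def h group_model is_group)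
  have "h (elt i j) = nf i j" for i j
  proof -
    have "h (elt i j) = nf 1 0 [^]\<^bsub>model\<^esub> i \<otimes>\<^bsub>model\<^esub> nf 0 1 [^]\<^bsub>model\<^esub> j"
      by (simp add: elt_def h.hom_nat_pow h.hom_int_pow h fab)
    then show ?thesis unfolding nf_pow_a nf_pow_b by (simp add: nf_mult)
  qed
  then show ?thesis using assms by metis
qed

lemma elt_eq_iff: "elt i j = elt k l \<longleftrightarrow> [i = k] (mod n) \<and> [j = l] (mod int m)"
proof
  assume *: "[i = k] (mod n) \<and> [j = l] (mod int m)"
  have "ord a dvd m" "ord b dvd n" using a_pow_m b_pow_n by (simp_all flip: pow_eq_id)
  then have "[i = k] (mod ord b)" "[j = l] (mod int (ord a))"
    using * by (auto intro: cong_dvd_modulus cong_dvd_modulus_nat)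
  then have "[int k = int i] (mod int (ord b))" "[l = j] (mod int (ord a))"
    by (simp_all add: cong_int_iff cong_sym)
  then have "b [^]\<^bsub>G\<^esub> int i = b [^]\<^bsub>G\<^esub> int k" "a [^]\<^bsub>G\<^esub> j = a [^]\<^bsub>G\<^esub> l"
    by (simp_all add: int_pow_eq cong_iff_dvd_diff)
  then show "elt i j = elt k l" by (simp add: elt_def int_pow_int)
qed (use elt_inj nf_eq_iff in blast)

sublocale split_metacyclic G m n r elt
  by unfold_locales (fact m_pos n_pos r_pow carrier_eq_elt elt_mult elt_eq_iff)+

end

theorem theorem3p4p1:
  fixes m n :: nat and r :: int
  assumes "m > 0" and "n > 0"
    and "gcd m n = 1" and "gcd (int m) (r - 1) = 1"
    and "[r ^ n = 1] (mod int m)"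
  shows "cdeg (ZM m n r) =
    real_of_int (\<Sum>m1 \<in> {d. d dvd m}. \<Sum>n1 \<in> {d. d dvd n \<and> int (m div m1) dvd r ^ d - 1}.
      gcd (int m1) (geom_quot r n n1)) /
    real_of_int (\<Sum>m1 \<in> {d. d dvd m}. \<Sum>n1 \<in> {d. d dvd n}.
      gcd (int m1) (geom_quot r n n1))"
proof -
  interpret zm_parameters m n r
    by unfold_locales fact+
  have "coprime m n" using assms(3) by (simp add: coprime_iff_gcd_eq_1)
  then show ?thesis
    by (simp only: cdeg_def of_int_of_nat_eq flip: card_cyclic_subgroups_of card_subgroups_of)
qed

end
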